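(* Let $M=(M_t)_{t\ge0}$ be a nonnegative supermartingale with respect to a filtration $\mathbb F=(\mathcal F_t)_{t\ge0}$ with $\mathbb E[M_0]\le1$, and let $\tau$ be any $\mathbb F$-stopping time. Let $U$ be a random variable that is uniform on $[0,1]$, or more generally stochastically larger than uniform on $[0,1]$, and independent of $\mathbb F$. Then for any $a>0$, $$P\big(\exists\, t<\tau:\ M_t\ge 1/a\ \text{ or }\ M_\tau\ge U/a\big)\le a,$$ i.e. the union of the event $\{\exists\,t<\tau: M_t\ge1/a\}$ and the event $\{M_\tau\ge U/a\}$ has probability at most $a$.
   Context: Time is discrete, $t\in\{0,1,2,\dots\}$. Independence of $U$ from $\mathbb F$ means independence from $\mathcal F_\infty=\sigma(\bigcup_t\mathcal F_t)$ (so $U$ is independent of $M$ and $\tau$). Stopping times may be infinite; on $\{\tau=\infty\}$, $M_\tau:=M_\infty:=\lim_{t\to\infty}M_t$, which exists almost surely. $U$ is stochastically larger than uniform on $[0,1]$ if $P(U\le u)\le u$ for all $u\in[0,1]$. *)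

theory Defs
  imports "HOL-Probability.Probability"
begin

definition filtration_on :: "'a measure \<Rightarrow> (nat \<Rightarrow> 'a measure) \<Rightarrow> bool" where
  "filtration_on P F \<longleftrightarrow> filtration (space P) F \<and> (\<forall>t. subalgebra P (F t))"

definition supermartingale :: "'a measure \<Rightarrow> (nat \<Rightarrow> 'a measure) \<Rightarrow> (nat \<Rightarrow> 'a \<Rightarrow> real) \<Rightarrow> bool" where
  "supermartingale P F M \<longleftrightarrow>
     (\<forall>t. M t \<in> borel_measurable (F t)) \<and>
     (\<forall>t. integrable P (M t)) \<and>
     (\<forall>s t. s \<le> t \<longrightarrow> (AE x in P. real_cond_exp P (F s) (M t) x \<le> M s x))"

text \<open>The constant \<^const>\<open>stopping_time\<close> takes its values in the index type of the filtration,
  so a stopping time of a \<^typ>\<open>nat\<close>-indexed filtration that may be infinite needs a version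
  with values in \<^typ>\<open>enat\<close>.\<close>

definition enat_stopping_time :: "(nat \<Rightarrow> 'a measure) \<Rightarrow> ('a \<Rightarrow> enat) \<Rightarrow> bool" where
  "enat_stopping_time F \<tau> \<longleftrightarrow> (\<forall>t::nat. Measurable.pred (F t) (\<lambda>x. \<tau> x \<le> enat t))"

text \<open>For a nonnegative supermartingale the limit exists almost surely; where it does not exist,
  \<^const>\<open>lim\<close> is a fixed unspecified constant, which affects the value on a null set only.\<close>

definition stopped_value :: "(nat \<Rightarrow> 'a \<Rightarrow> real) \<Rightarrow> ('a \<Rightarrow> enat) \<Rightarrow> 'a \<Rightarrow> real" where
  "stopped_value M \<tau> x = (case \<tau> x of enat t \<Rightarrow> M t x | \<infinity> \<Rightarrow> lim (\<lambda>t. M t x))"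

definition filtration_infinity :: "'a measure \<Rightarrow> (nat \<Rightarrow> 'a measure) \<Rightarrow> 'a measure" where
  "filtration_infinity P F = sigma (space P) (\<Union>t. sets (F t))"

definition indep_of_filtration :: "'a measure \<Rightarrow> (nat \<Rightarrow> 'a measure) \<Rightarrow> ('a \<Rightarrow> real) \<Rightarrow> bool" where
  "indep_of_filtration P F U \<longleftrightarrow>
     prob_space.indep_set P (sets (vimage_algebra (space P) U borel)) (sets (filtration_infinity P F))"

definition stochastically_ge_uniform :: "'a measure \<Rightarrow> ('a \<Rightarrow> real) \<Rightarrow> bool" where
  "stochastically_ge_uniform P U \<longleftrightarrow> (\<forall>u\<in>{0..1}. \<P>(x in P. U x \<le> u) \<le> u)"

lemma uniform_imp_stochastically_ge_uniform:
  assumes "prob_space P" and "distr P borel U = uniform_measure lborel {0..1}"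
    and [measurable]: "U \<in> borel_measurable P"
  shows "stochastically_ge_uniform P U"
  unfolding stochastically_ge_uniform_def
proof
  fix u :: real assume u: "u \<in> {0..1}"
  have "\<P>(x in P. U x \<le> u) = measure (distr P borel U) {..u}"
    by (subst measure_distr) (auto simp: vimage_def Int_def conj_commute)
  also have "\<dots> = measure lborel ({0..1} \<inter> {..u}) / measure lborel {0..1::real}"
    unfolding assms(2) by (rule measure_uniform_measure) auto
  also have "{0..1} \<inter> {..u} = {0..u}"
    using u by auto
  finally show "\<P>(x in P. U x \<le> u) \<le> u"
    using u by simp
qed

lemma exceedance_event_measurable:
  assumes F: "filtration_on P F" and M: "supermartingale P F M"
    and T: "enat_stopping_time F \<tau>" and [measurable]: "U \<in> borel_measurable P"
  shows "{x \<in> space P. (\<exists>t::nat. enat t < \<tau> x \<and> M t x \<ge> 1 / a) \<or> stopped_value M \<tau> x \<ge> U x / a} \<in> sets P"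
proof -
  have [measurable]: "M t \<in> borel_measurable P" for t
    using M by (auto simp: supermartingale_def)
  have le: "Measurable.pred P (\<lambda>x. \<tau> x \<le> enat t)" for t
    using T F measurable_from_subalg[of P "F t"]
    by (auto simp: enat_stopping_time_def filtration_on_def)
  have [measurable]: "Measurable.pred P (\<lambda>x. enat t < \<tau> x)" for t
    unfolding not_le[symmetric] using le by measurable
  have [measurable]: "Measurable.pred P (\<lambda>x. \<tau> x = \<infinity>)"
  proof -
    have "(\<lambda>x. \<tau> x = \<infinity>) = (\<lambda>x. \<forall>t. enat t < \<tau> x)"
      by (metis enat_iless enat_ord_simps(4) less_irrefl not_infinity_eq)
    then show ?thesis by simp
  qed
  have [measurable]: "Measurable.pred P (\<lambda>x. \<tau> x = enat t)" for t
  proof -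
    have "(\<lambda>x. \<tau> x = enat t) = (\<lambda>x. \<tau> x \<le> enat t \<and> (\<forall>s<t. enat s < \<tau> x))"
      by (auto simp: fun_eq_iff) (metis enat_iless enat_ord_simps(2) less_irrefl order_le_less)
    then show ?thesis using le by simp
  qed
  have "stopped_value M \<tau> x \<ge> U x / a \<longleftrightarrow>
      (\<exists>t. \<tau> x = enat t \<and> M t x \<ge> U x / a) \<or> (\<tau> x = \<infinity> \<and> lim (\<lambda>t. M t x) \<ge> U x / a)" for x
    by (cases "\<tau> x") (auto simp: stopped_value_def)
  then show ?thesis by simp
qed

end

theory Submission
  imports Defs
begin

text \<open>Stop \<open>M\<close> at the earlier of \<open>\<tau>\<close> and the first time it reaches \<open>1 / a\<close>. The stopped process converges
  almost surely to a limit \<open>V\<close>, with \<open>E V \<le> 1\<close> by Fatou's lemma, and the event in question is almost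
  surely contained in \<open>U \<le> a V \<or> 1 \<le> a V\<close>. Since \<open>V\<close> is independent of \<open>U\<close>, conditioning on \<open>V\<close> bounds
  the probability of the latter by \<open>E (min 1 (a V)) \<le> a\<close>. Almost sure convergence on \<open>\<tau> = \<infinity>\<close> comes from
  Dubins' upcrossing inequality. Working with \<open>ennreal\<close>-valued processes avoids all integrability
  conditions.\<close>

section \<open>Nonnegative supermartingales and piecewise strategies\<close>

text \<open>The conditional inequality is encoded in tested form, integrated over one time step
  against a nonnegative \<open>F t\<close>-measurable weight, so that no conditional expectation
  appears in the arguments below.\<close>

locale nn_supermartingale = prob_space P + filtration "space P" F
  for P :: "'a measure" and F :: "nat \<Rightarrow> 'a measure" +
  fixes N :: "nat \<Rightarrow> 'a \<Rightarrow> ennreal"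
  assumes subalg: "subalgebra P (F t)"
    and adapted: "N t \<in> borel_measurable (F t)"
    and nn_integral_le: "g \<in> borel_measurable (F t) \<Longrightarrow>
      (\<integral>\<^sup>+x. g x * N (Suc t) x \<partial>P) \<le> (\<integral>\<^sup>+x. g x * N t x \<partial>P)"
begin

lemma measurable_F_mono: "f \<in> measurable (F s) R \<Longrightarrow> s \<le> t \<Longrightarrow> f \<in> measurable (F t) R"
  using sets_F_mono[of s t] by (auto simp: measurable_def space_F)

lemma measurable_F_P: "f \<in> measurable (F s) R \<Longrightarrow> f \<in> measurable P R"
  using measurable_from_subalg subalg by blast

lemma measurable_N [measurable]: "N t \<in> borel_measurable P"
  using measurable_F_P adapted by blast

text \<open>Over the step from \<open>t\<close> to \<open>Suc t\<close> the affine rule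
  \<open>g t * N + h t\<close> is fixed at time \<open>t\<close>, so its mean cannot increase;
  changing to the next rule can only lower the value. The upcrossing bound and optional stopping are
  both instances.\<close>

lemma spliced_nn_integral_le:
  fixes Z g h :: "nat \<Rightarrow> 'a \<Rightarrow> ennreal"
  assumes g: "\<And>t. g t \<in> borel_measurable (F t)" and h: "\<And>t. h t \<in> borel_measurable (F t)"
    and now: "\<And>t x. x \<in> space P \<Longrightarrow> g t x * N t x + h t x \<le> Z t x"
    and later: "\<And>t x. x \<in> space P \<Longrightarrow> Z (Suc t) x \<le> g t x * N (Suc t) x + h t x"
  shows "(\<integral>\<^sup>+x. Z t x \<partial>P) \<le> (\<integral>\<^sup>+x. Z 0 x \<partial>P)"
proof (induction t)
  case (Suc t)
  have [measurable]: "g t \<in> borel_measurable P" "h t \<in> borel_measurable P"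
    by (rule measurable_F_P, rule g, rule measurable_F_P, rule h)
  have "(\<integral>\<^sup>+x. Z (Suc t) x \<partial>P) \<le> (\<integral>\<^sup>+x. g t x * N (Suc t) x + h t x \<partial>P)"
    using later by (intro nn_integral_mono)
  also have "\<dots> = (\<integral>\<^sup>+x. g t x * N (Suc t) x \<partial>P) + (\<integral>\<^sup>+x. h t x \<partial>P)"
    by (simp add: nn_integral_add)
  also have "\<dots> \<le> (\<integral>\<^sup>+x. g t x * N t x \<partial>P) + (\<integral>\<^sup>+x. h t x \<partial>P)"
    by (intro add_right_mono nn_integral_le g)
  also have "\<dots> = (\<integral>\<^sup>+x. g t x * N t x + h t x \<partial>P)"
    by (simp add: nn_integral_add)
  also have "\<dots> \<le> (\<integral>\<^sup>+x. Z t x \<partial>P)"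
    using now by (intro nn_integral_mono)
  finally show ?case using Suc by simp
qed simp

end

section \<open>Upcrossings and almost sure convergence\<close>

text \<open>\<open>crossings a b f n\<close> counts the alternating passages below \<open>a\<close> and above \<open>b\<close> among
  \<open>f 0, \<dots>, f n\<close>, so an upcrossing is completed whenever it becomes even.\<close>

fun switch :: "'b::linorder \<Rightarrow> 'b \<Rightarrow> nat \<Rightarrow> 'b \<Rightarrow> nat" where
  "switch a b p y =
     (if even p then if y \<le> a then Suc p else p else if b \<le> y then Suc p else p)"

primrec crossings :: "'b::linorder \<Rightarrow> 'b \<Rightarrow> (nat \<Rightarrow> 'b) \<Rightarrow> nat \<Rightarrow> nat" where
  "crossings a b f 0 = switch a b 0 (f 0)"
| "crossings a b f (Suc n) = switch a b (crossings a b f n) (f (Suc n))"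

lemma mono_crossings: "mono (crossings a b f)"
  by (rule mono_iff_le_Suc[THEN iffD2]) auto

lemma crossings_unbounded:
  assumes low: "\<exists>\<^sub>F n in sequentially. f n \<le> a" and high: "\<exists>\<^sub>F n in sequentially. b \<le> f n"
  shows "\<exists>n. k \<le> crossings a b f n"
proof (induction k)
  case (Suc k)
  then obtain n where n: "k \<le> crossings a b f n" by blast
  obtain l where l: "l > n" "f l \<le> a"
    using low unfolding frequently_sequentially by (metis Suc_le_lessD)
  obtain u where u: "u > n" "b \<le> f u"
    using high unfolding frequently_sequentially by (metis Suc_le_lessD)
  obtain l' where l': "l = Suc l'" "n \<le> l'" using l by (cases l) auto
  obtain u' where u': "u = Suc u'" "n \<le> u'" using u by (cases u) auto
  have "k \<le> crossings a b f l'" "k \<le> crossings a b f u'"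
    using n l' u' monoD[OF mono_crossings] order_trans by blast+
  moreover have "Suc (crossings a b f l') \<le> crossings a b f l" if "even (crossings a b f l')"
    using that l l' by simp
  moreover have "Suc (crossings a b f u') \<le> crossings a b f u" if "odd (crossings a b f u')"
    using that u u' by simp
  \<comment> \<open>If neither implication applies, the count is odd at \<open>l'\<close> and even
    at \<open>u'\<close>. The two counts then differ, and as both are at least \<open>k\<close>, one
    of them is at least \<open>Suc k\<close>.\<close>
  ultimately show ?case
    by (metis Suc_le_mono le_antisym not_less_eq_eq order_trans)
qed simp

context nn_supermartingale
begin

lemma measurable_crossings: "(\<lambda>x. crossings a b (\<lambda>n. N n x) t) \<in> measurable (F t) (count_space UNIV)"
proof (induction t)
  case 0
  have [measurable]: "N 0 \<in> borel_measurable (F 0)" by (rule adapted)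
  show ?case by simp
next
  case (Suc t)
  have [measurable]: "N (Suc t) \<in> borel_measurable (F (Suc t))" by (rule adapted)
  have [measurable]: "(\<lambda>x. crossings a b (\<lambda>n. N n x) t) \<in> measurable (F (Suc t)) (count_space UNIV)"
    using measurable_F_mono[OF Suc] by simp
  show ?case by simp
qed

lemma emeasure_crossings_le:
  fixes a b :: real
  assumes "0 < a" "a < b"
  shows "emeasure P {x \<in> space P. 2 * K \<le> crossings (ennreal a) (ennreal b) (\<lambda>n. N n x) t} \<le> ennreal ((a / b) ^ K)"
proof -
  text \<open>Dubins' argument: let \<open>Z\<close> be constant while the path waits to fall to \<open>a\<close> and a multiple of
    \<open>N / a\<close> while it waits to rise to \<open>b\<close>. Neither switch increases \<open>Z\<close> beyond the value of the old
    rule, and each completed upcrossing multiplies the constant by \<open>b / a\<close>.\<close>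
  let ?q = "\<lambda>t x. crossings (ennreal a) (ennreal b) (\<lambda>n. N n x) t"
  define r where "r = ennreal (b / a)"
  \<comment> \<open>With \<open>j\<close> upcrossings completed, \<open>Z\<close> is
    \<open>r ^ j\<close> while waiting to fall and \<open>r ^ j * N / a\<close> while waiting to
    rise. After \<open>2 * K\<close> passages it is frozen at \<open>r ^ K\<close>.\<close>
  define g where "g t x = (if ?q t x < 2 * K \<and> odd (?q t x) then r ^ (?q t x div 2) * ennreal (1 / a) else 0)" for t x
  define h where "h t x = (if ?q t x < 2 * K \<and> odd (?q t x) then 0 else r ^ min K (?q t x div 2))" for t x
  define Z where "Z t x = g t x * N t x + h t x" for t x
  have q[measurable]: "?q t \<in> measurable (F t) (count_space UNIV)" for t
    by (rule measurable_crossings)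
  have low: "ennreal (1 / a) * y \<le> 1" if "y \<le> ennreal a" for y
  proof -
    have "ennreal (1 / a) * y \<le> ennreal (1 / a) * ennreal a"
      using that by (rule mult_left_mono) simp
    also have "\<dots> = 1" using assms by (simp add: ennreal_mult[symmetric])
    finally show ?thesis .
  qed
  have high: "r \<le> ennreal (1 / a) * y" if "ennreal b \<le> y" for y
  proof -
    have "r = ennreal (1 / a) * ennreal b"
      using assms by (simp add: r_def ennreal_mult[symmetric])
    also have "\<dots> \<le> ennreal (1 / a) * y"
      using that by (rule mult_left_mono) simp
    finally show ?thesis .
  qed
  have "Z (Suc t) x \<le> g t x * N (Suc t) x + h t x" for t x
  proof (cases "?q t x < 2 * K")
    case False
    then show ?thesis by (auto simp: Z_def g_def h_def min_def)
  next
    case True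
    show ?thesis
    proof (cases "even (?q t x)")
      case even: True
      then have K: "\<not> K \<le> ?q t x div 2" using True by auto
      show ?thesis
      proof (cases "N (Suc t) x \<le> ennreal a")
        case True': True
        have "r ^ (?q t x div 2) * (ennreal (1 / a) * N (Suc t) x) \<le> r ^ (?q t x div 2) * 1"
          by (intro mult_left_mono low True') simp
        \<comment> \<open>An even count below \<open>2 * K\<close> is at most
          \<open>2 * K - 2\<close>, so the new odd count still falls under the rising rule.\<close>
        moreover have "Suc (?q t x) < 2 * K" using True even by presburger
        ultimately show ?thesis
          using True True' even K by (simp add: Z_def g_def h_def mult.assoc min_def)
      qed (use True even in \<open>simp add: Z_def g_def h_def\<close>)
    next
      case odd: False
      show ?thesis
      proof (cases "ennreal b \<le> N (Suc t) x")
        case True': True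
        have "r ^ (?q t x div 2) * r \<le> r ^ (?q t x div 2) * (ennreal (1 / a) * N (Suc t) x)"
          by (intro mult_left_mono high True') simp
        moreover have "Suc (?q t x) div 2 = Suc (?q t x div 2)" "Suc (?q t x div 2) \<le> K"
          using True odd by presburger+
        ultimately show ?thesis
          using True True' odd by (simp add: Z_def g_def h_def mult_ac min_absorb2)
      qed (use True odd in \<open>simp add: Z_def g_def h_def\<close>)
    qed
  qed
  moreover have "g t \<in> borel_measurable (F t)" "h t \<in> borel_measurable (F t)" for t
    unfolding g_def h_def by measurable
  moreover have "g t x * N t x + h t x \<le> Z t x" for t x by (simp add: Z_def)
  ultimately have "(\<integral>\<^sup>+x. Z t x \<partial>P) \<le> (\<integral>\<^sup>+x. Z 0 x \<partial>P)"
    by (intro spliced_nn_integral_le)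
  also have "\<dots> \<le> (\<integral>\<^sup>+x. 1 \<partial>P)"
    \<comment> \<open>At time 0 at most one passage has been made: \<open>Z\<close> is 1, or it is
      \<open>N 0 / a\<close> with \<open>N 0\<close> at most \<open>a\<close>.\<close>
    by (rule nn_integral_mono) (auto simp: Z_def g_def h_def low)
  also have "\<dots> = 1" by (simp add: emeasure_space_1)
  finally have Z: "(\<integral>\<^sup>+x. Z t x \<partial>P) \<le> 1" .
  have [measurable]: "?q t \<in> measurable P (count_space UNIV)"
    using q measurable_F_P by blast
  let ?A = "{x \<in> space P. 2 * K \<le> ?q t x}"
  \<comment> \<open>Markov's inequality: \<open>Z\<close> equals \<open>r ^ K\<close> on
    \<open>?A\<close>. The factor is then cancelled by multiplying with \<open>(a / b) ^ K\<close>,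
    which avoids division in \<open>ennreal\<close>.\<close>
  have "r ^ K * emeasure P ?A = (\<integral>\<^sup>+x. r ^ K * indicator ?A x \<partial>P)"
    by (simp add: nn_integral_cmult_indicator)
  also have "\<dots> \<le> (\<integral>\<^sup>+x. Z t x \<partial>P)"
    by (rule nn_integral_mono) (auto simp: Z_def g_def h_def min_def indicator_def)
  finally have rA: "r ^ K * emeasure P ?A \<le> 1" using Z by simp
  have "emeasure P ?A = (ennreal ((a / b) ^ K) * r ^ K) * emeasure P ?A"
    using assms by (simp add: r_def ennreal_power ennreal_mult[symmetric] power_mult_distrib[symmetric])
  also have "\<dots> \<le> ennreal ((a / b) ^ K)"
    using mult_left_mono[OF rA, of "ennreal ((a / b) ^ K)"] by (simp add: mult.assoc)
  finally show ?thesis .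
qed

text \<open>An oscillating path makes unboundedly many passages. The bound on \<open>K\<close>
  upcrossings is uniform in \<open>t\<close>, so by continuity from below it holds for the whole
  path, and it tends to 0 as \<open>K\<close> grows.\<close>

lemma AE_not_oscillating:
  fixes a b :: real
  assumes "0 < a" "a < b"
  shows "AE x in P. \<not> ((\<exists>\<^sub>F n in sequentially. N n x \<le> a) \<and> (\<exists>\<^sub>F n in sequentially. b \<le> N n x))"
proof -
  let ?q = "\<lambda>t x. crossings (ennreal a) (ennreal b) (\<lambda>n. N n x) t"
  have [measurable]: "?q t \<in> measurable P (count_space UNIV)" for t
    using measurable_crossings measurable_F_P by blast
  define A where "A K t = {x \<in> space P. 2 * K \<le> ?q t x}" for K t
  define B where "B = (\<Inter>K. \<Union>t. A K t)"
  have [measurable]: "A K t \<in> sets P" for K t unfolding A_def by measurable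
  have [measurable]: "B \<in> sets P" unfolding B_def by measurable
  have "emeasure P B \<le> ennreal ((a / b) ^ K)" for K
  proof -
    have "incseq (A K)"
      unfolding A_def incseq_def
      using monoD[OF mono_crossings] order_trans by blast
    then have "emeasure P (\<Union>t. A K t) = (SUP t. emeasure P (A K t))"
      by (intro SUP_emeasure_incseq[symmetric]) auto
    also have "\<dots> \<le> ennreal ((a / b) ^ K)"
      unfolding A_def by (intro SUP_least emeasure_crossings_le assms)
    finally show ?thesis
      by (rule order_trans[rotated]) (auto simp: B_def intro!: emeasure_mono)
  qed
  moreover have "(\<lambda>K. ennreal ((a / b) ^ K)) \<longlonglongrightarrow> ennreal 0"
    using assms by (intro tendsto_ennrealI LIMSEQ_power_zero) simp
  ultimately have "emeasure P B \<le> ennreal 0"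
    by (intro LIMSEQ_le_const) auto
  then have "B \<in> null_sets P" by (auto intro: null_setsI)
  then show ?thesis
  proof (rule AE_I')
    show "{x \<in> space P. \<not> \<not> ((\<exists>\<^sub>F n in sequentially. N n x \<le> a) \<and> (\<exists>\<^sub>F n in sequentially. b \<le> N n x))} \<subseteq> B"
      using crossings_unbounded by (fastforce simp: B_def A_def)
  qed
qed

text \<open>Off a countable union of null sets no path oscillates across a rational pair, whereas a
  gap between liminf and limsup would contain such a pair. The limit lives in
  \<open>ennreal\<close>, so divergence to infinity counts as convergence.\<close>

theorem AE_convergent: "AE x in P. \<exists>l. (\<lambda>n. N n x) \<longlonglongrightarrow> l"
proof -
  have "AE x in P. \<forall>a::rat. \<forall>b::rat. 0 < a \<longrightarrow> a < b \<longrightarrow>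
     \<not> ((\<exists>\<^sub>F n in sequentially. N n x \<le> ennreal (of_rat a)) \<and> (\<exists>\<^sub>F n in sequentially. ennreal (of_rat b) \<le> N n x))"
    unfolding AE_all_countable
    by (intro allI AE_impI AE_not_oscillating) (auto simp: of_rat_less)
  then show ?thesis
  proof eventually_elim
    case (elim x)
    let ?N = "\<lambda>n. N n x"
    have "\<not> liminf ?N < limsup ?N"
    proof
      assume "liminf ?N < limsup ?N"
      then obtain a :: rat where a: "liminf ?N < ennreal (of_rat a)" "ennreal (of_rat a) < limsup ?N"
        using ennreal_rat_dense by blast
      then obtain b :: rat where b: "ennreal (of_rat a) < ennreal (of_rat b)" "ennreal (of_rat b) < limsup ?N"
        using ennreal_rat_dense by blast
      have "0 < ennreal (of_rat a)" using a(1) by (rule le_less_trans[rotated]) simp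
      then have "0 < a" by simp
      moreover have "a < b" using b(1) \<open>0 < a\<close> by (simp add: ennreal_less_iff of_rat_less)
      moreover have "\<exists>\<^sub>F n in sequentially. ?N n \<le> ennreal (of_rat a)"
      proof (rule ccontr)
        assume "\<not> ?thesis"
        then have "\<forall>\<^sub>F n in sequentially. ennreal (of_rat a) \<le> ?N n"
          unfolding not_frequently by (auto elim: eventually_mono)
        from Liminf_bounded[OF this] show False using a(1) by simp
      qed
      moreover have "\<exists>\<^sub>F n in sequentially. ennreal (of_rat b) \<le> ?N n"
      proof (rule ccontr)
        assume "\<not> ?thesis"
        then have "\<forall>\<^sub>F n in sequentially. ?N n \<le> ennreal (of_rat b)"
          unfolding not_frequently by (auto elim: eventually_mono)
        from Limsup_bounded[OF this] show False using b(2) by simp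
      qed
      ultimately show False using elim by blast
    qed
    then have "liminf ?N = limsup ?N"
      using Liminf_le_Limsup[of sequentially ?N] by auto
    then have "?N \<longlonglongrightarrow> limsup ?N"
      by (intro Liminf_eq_Limsup) auto
    then show ?case ..
  qed
qed

section \<open>Stopped processes\<close>

text \<open>\<open>D t x\<close> says that the path \<open>x\<close> has been stopped by time \<open>t\<close>.\<close>

primrec stopped :: "(nat \<Rightarrow> 'a \<Rightarrow> bool) \<Rightarrow> nat \<Rightarrow> 'a \<Rightarrow> ennreal" where
  "stopped D 0 x = N 0 x"
| "stopped D (Suc t) x = (if D t x then stopped D t x else N (Suc t) x)"

text \<open>Only times strictly before \<open>t\<close> matter: stopping at \<open>t\<close> freezes
  the process from \<open>Suc t\<close> on, so the value at the stopping time is still that of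
  \<open>N\<close>.\<close>

lemma stopped_eq:
  assumes "\<And>s. s < t \<Longrightarrow> \<not> D s x"
  shows "stopped D t x = N t x"
  using assms by (cases t) auto

lemma stopped_const:
  assumes "\<And>s. s \<ge> t \<Longrightarrow> D s x" "t \<le> u"
  shows "stopped D u x = stopped D t x"
  using assms(2) by (induction u rule: dec_induct) (auto simp: assms(1))

lemma measurable_stopped:
  assumes D: "\<And>t. Measurable.pred (F t) (D t)"
  shows "stopped D t \<in> borel_measurable (F t)"
proof (induction t)
  case 0
  then show ?case by (simp add: adapted)
next
  case (Suc t)
  have [measurable]: "stopped D t \<in> borel_measurable (F (Suc t))"
    "Measurable.pred (F (Suc t)) (D t)" "N (Suc t) \<in> borel_measurable (F (Suc t))"
    using measurable_F_mono[OF Suc] measurable_F_mono[OF D] adapted by auto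
  show ?case by simp
qed

lemma nn_integral_stopped_le:
  assumes D: "\<And>t. Measurable.pred (F t) (D t)"
    and mono: "\<And>t x. D t x \<Longrightarrow> D (Suc t) x"
  shows "(\<integral>\<^sup>+x. stopped D t x \<partial>P) \<le> (\<integral>\<^sup>+x. N 0 x \<partial>P)"
proof -
  note [measurable] = D measurable_stopped[OF D]
  have eq: "stopped D t x = N t x" if "\<not> D t x" for t x
    using that by (cases t) (auto dest: mono)
  have "(\<integral>\<^sup>+x. stopped D t x \<partial>P) \<le> (\<integral>\<^sup>+x. stopped D 0 x \<partial>P)"
    by (rule spliced_nn_integral_le[where g = "\<lambda>t x. if D t x then 0 else 1"
          and h = "\<lambda>t x. if D t x then stopped D t x else 0"])
       (auto simp: eq)
  then show ?thesis by simp
qed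

end

section \<open>From real-valued to extended nonnegative processes\<close>

lemma nn_supermartingale_ennreal:
  assumes P: "prob_space P" and F: "filtration_on P F" and M: "supermartingale P F M"
    and nonneg: "\<And>t. AE x in P. 0 \<le> M t x"
  shows "nn_supermartingale P F (\<lambda>t x. ennreal (M t x))"
proof -
  interpret prob_space P by fact
  interpret filtration "space P" F using F by (simp add: filtration_on_def)
  have sub: "subalgebra P (F t)" for t using F by (simp add: filtration_on_def)
  have ad [measurable]: "M t \<in> borel_measurable (F t)" for t using M by (simp add: supermartingale_def)
  have [measurable]: "M t \<in> borel_measurable P" for t using measurable_from_subalg[OF sub ad] .
  have int: "integrable P (M t)" for t using M by (simp add: supermartingale_def)
  show ?thesis
  proof
    show "subalgebra P (F t)" for t by (rule sub)
    show "(\<lambda>x. ennreal (M t x)) \<in> borel_measurable (F t)" for t by measurable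
    fix g :: "'a \<Rightarrow> ennreal" and t
    assume g[measurable]: "g \<in> borel_measurable (F t)"
    interpret finite_measure_subalgebra P "F t" by standard (rule sub)
    let ?C = "nn_cond_exp P (F t) (\<lambda>x. ennreal (M (Suc t) x))"
    \<comment> \<open>\<open>real_cond_exp\<close> is a difference of two nonnegative conditional
      expectations; the one of the negative part vanishes almost surely.\<close>
    have "AE x in P. nn_cond_exp P (F t) (\<lambda>x. ennreal (- M (Suc t) x)) x = nn_cond_exp P (F t) (\<lambda>x. 0) x"
      using nonneg[of "Suc t"] by (intro nn_cond_exp_cong) (auto simp: ennreal_neg)
    moreover have "AE x in P. 0 = nn_cond_exp P (F t) (\<lambda>x. 0) x"
      by (rule nn_cond_exp_F_meas) simp
    \<comment> \<open>Finiteness matters because \<open>enn2real\<close> sends infinity to 0, which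
      would make the real inequality uninformative about \<open>?C\<close>.\<close>
    moreover have "AE x in P. ?C x \<noteq> \<infinity>"
    proof (rule nn_integral_PInf_AE)
      have "(\<integral>\<^sup>+x. ?C x \<partial>P) = (\<integral>\<^sup>+x. ennreal (M (Suc t) x) \<partial>P)"
        using nn_cond_exp_intg[of "\<lambda>_. 1" "\<lambda>x. ennreal (M (Suc t) x)"] by simp
      also have "\<dots> \<noteq> \<infinity>"
        using nn_integral_eq_integral[OF int nonneg] by simp
      finally show "(\<integral>\<^sup>+x. ?C x \<partial>P) \<noteq> \<infinity>" .
    qed simp
    moreover have "AE x in P. real_cond_exp P (F t) (M (Suc t)) x \<le> M t x"
      using M by (simp add: supermartingale_def)
    ultimately have le: "AE x in P. ?C x \<le> ennreal (M t x)"
    proof eventually_elim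
      case (elim x)
      then have "enn2real (?C x) \<le> M t x" by (simp add: real_cond_exp_def)
      then have "ennreal (enn2real (?C x)) \<le> ennreal (M t x)" by (rule ennreal_leI)
      then show ?case using elim by (simp add: less_top)
    qed
    have "(\<integral>\<^sup>+x. g x * ennreal (M (Suc t) x) \<partial>P) = (\<integral>\<^sup>+x. g x * ?C x \<partial>P)"
      by (intro nn_cond_exp_intg[symmetric]) auto
    also have "\<dots> \<le> (\<integral>\<^sup>+x. g x * ennreal (M t x) \<partial>P)"
      using le by (intro nn_integral_mono_AE) (auto elim!: eventually_mono intro: mult_left_mono)
    finally show "(\<integral>\<^sup>+x. g x * ennreal (M (Suc t) x) \<partial>P) \<le> (\<integral>\<^sup>+x. g x * ennreal (M t x) \<partial>P)" .
  qed
qed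

section \<open>Randomized thresholds and independence\<close>

text \<open>By Fubini it suffices to bound the slice at each fixed \<open>y\<close> by
  \<open>y\<close>. For \<open>y\<close> below 1 this is the assumption on \<open>U\<close>; from 1
  on any probability is at most \<open>y\<close>, so adding the alternative \<open>1 \<le> Y\<close>
  costs nothing.\<close>

lemma (in prob_space) emeasure_randomized_threshold_le:
  fixes U Y :: "'a \<Rightarrow> real"
  assumes indep: "indep_var borel U borel Y" and U: "stochastically_ge_uniform M U"
    and Y: "\<And>x. 0 \<le> Y x"
  shows "emeasure M {x \<in> space M. U x \<le> Y x \<or> 1 \<le> Y x} \<le> (\<integral>\<^sup>+x. ennreal (Y x) \<partial>M)"
proof -
  have [measurable]: "U \<in> borel_measurable M" "Y \<in> borel_measurable M"
    using indep unfolding indep_var_distribution_eq by auto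
  interpret U: prob_space "distr M borel U" by (rule prob_space_distr) simp
  interpret Y: prob_space "distr M borel Y" by (rule prob_space_distr) simp
  interpret UY: pair_sigma_finite "distr M borel U" "distr M borel Y" ..
  let ?A = "{(u, y). u \<le> y \<or> 1 \<le> y} :: (real \<times> real) set"
  have A[measurable]: "?A \<in> sets (borel \<Otimes>\<^sub>M borel)"
  proof -
    have "Measurable.pred (borel \<Otimes>\<^sub>M borel) (\<lambda>p :: real \<times> real. fst p \<le> snd p \<or> 1 \<le> snd p)"
      by measurable
    then show ?thesis by (simp add: pred_def space_pair_measure case_prod_beta')
  qed
  have slice: "emeasure (distr M borel U) {u. u \<le> y \<or> 1 \<le> y} \<le> ennreal y" if "0 \<le> y" for y
  proof (cases "1 \<le> y")
    case True
    then have "1 \<le> ennreal y" by simp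
    then show ?thesis using U.emeasure_le_1 order_trans by blast
  next
    case False
    have "prob {x \<in> space M. U x \<le> y} \<le> y"
      using U False that by (auto simp: stochastically_ge_uniform_def)
    then show ?thesis
      using False
      by (auto simp: emeasure_distr emeasure_eq_measure vimage_def Int_def conj_commute intro: ennreal_leI)
  qed
  have "emeasure M {x \<in> space M. U x \<le> Y x \<or> 1 \<le> Y x} =
      emeasure (distr M (borel \<Otimes>\<^sub>M borel) (\<lambda>x. (U x, Y x))) ?A"
    by (subst emeasure_distr) (auto intro!: arg_cong2[where f = emeasure])
  also have "\<dots> = emeasure (distr M borel U \<Otimes>\<^sub>M distr M borel Y) ?A"
    using indep by (simp add: indep_var_distribution_eq)
  also have "\<dots> = (\<integral>\<^sup>+y. emeasure (distr M borel U) ((\<lambda>u. (u, y)) -` ?A) \<partial>distr M borel Y)"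
    by (rule UY.emeasure_pair_measure_alt2) simp
  also have "\<dots> = (\<integral>\<^sup>+x. emeasure (distr M borel U) ((\<lambda>u. (u, Y x)) -` ?A) \<partial>M)"
    using UY.measurable_emeasure_Pair2[of ?A] by (intro nn_integral_distr) simp_all
  also have "\<dots> \<le> (\<integral>\<^sup>+x. ennreal (Y x) \<partial>M)"
    using slice Y by (intro nn_integral_mono) (simp add: vimage_def)
  finally show ?thesis .
qed

lemma measurable_filtration_infinity:
  assumes "filtration_on P F" "f \<in> measurable (F t) R"
  shows "f \<in> measurable (filtration_infinity P F) R"
proof (rule measurable_from_subalg[OF _ assms(2)])
  have F: "space (F s) = space P" for s
    using assms by (simp add: filtration_on_def filtration_def)
  have "(\<Union>s. sets (F s)) \<subseteq> Pow (space P)"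
    using sets.sets_into_space F by fastforce
  then show "subalgebra (filtration_infinity P F) (F t)"
    unfolding subalgebra_def filtration_infinity_def
    by (auto simp: space_measure_of sets_measure_of F)
qed

lemma indep_var_of_filtration:
  assumes P: "prob_space P" and F: "filtration_on P F" and U: "U \<in> borel_measurable P"
    and indep: "indep_of_filtration P F U" and Y: "Y \<in> borel_measurable (filtration_infinity P F)"
    and Y': "Y \<in> borel_measurable P"
  shows "prob_space.indep_var P borel U borel (Y :: 'a \<Rightarrow> real)"
proof -
  interpret prob_space P by fact
  have sp: "space (filtration_infinity P F) = space P"
    unfolding filtration_infinity_def by (simp add: space_measure_of_conv)
  have "sigma_sets (space P) {U -` A \<inter> space P |A. A \<in> sets borel} \<subseteq>
      sets (vimage_algebra (space P) U borel)"
    by (simp add: sets_vimage_algebra)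
  moreover have "sigma_sets (space P) {Y -` A \<inter> space P |A. A \<in> sets borel} \<subseteq>
      sets (filtration_infinity P F)"
    using measurable_sets[OF Y]
    by (intro sets.sigma_sets_subset[of _ "filtration_infinity P F", unfolded sp]) (auto simp: sp)
  ultimately show ?thesis
    using indep U Y' unfolding indep_var_eq indep_of_filtration_def indep_sets2_eq
    by blast
qed

section \<open>The stopped supermartingale against the randomized threshold\<close>

theorem corollary4p1p1:
  fixes P :: "'a measure" and F :: "nat \<Rightarrow> 'a measure" and M :: "nat \<Rightarrow> 'a \<Rightarrow> real"
    and \<tau> :: "'a \<Rightarrow> enat" and U :: "'a \<Rightarrow> real" and a :: real
  assumes "prob_space P"
    and "filtration_on P F"
    and "supermartingale P F M"
    and "\<And>t. AE x in P. 0 \<le> M t x"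
    and "(\<integral>x. M 0 x \<partial>P) \<le> 1"
    and "enat_stopping_time F \<tau>"
    and "U \<in> borel_measurable P"
    and "stochastically_ge_uniform P U"
    and "indep_of_filtration P F U"
    and "a > 0"
  shows "\<P>(x in P. (\<exists>t::nat. enat t < \<tau> x \<and> M t x \<ge> 1 / a) \<or> stopped_value M \<tau> x \<ge> U x / a) \<le> a"
proof -
  interpret nn_supermartingale P F "\<lambda>t x. ennreal (M t x)"
    by (rule nn_supermartingale_ennreal) fact+
  have M_meas: "M t \<in> borel_measurable (F t)" for t
    using assms(3) by (simp add: supermartingale_def)
  define D where "D = (\<lambda>t x. \<tau> x \<le> enat t \<or> (\<exists>s\<le>t. 1 / a \<le> M s x))"
  have D: "Measurable.pred (F t) (D t)" for t
  proof -
    have "Measurable.pred (F t) (\<lambda>x. \<tau> x \<le> enat t)"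
      using assms(6) by (simp add: enat_stopping_time_def)
    moreover have "Measurable.pred (F t) (\<lambda>x. s \<le> t \<and> 1 / a \<le> M s x)" for s
    proof (cases "s \<le> t")
      case True
      then have [measurable]: "M s \<in> borel_measurable (F t)"
        using measurable_F_mono M_meas by blast
      show ?thesis by measurable
    qed simp
    then have "Measurable.pred (F t) (\<lambda>x. \<exists>s\<le>t. 1 / a \<le> M s x)"
      by measurable
    ultimately show ?thesis unfolding D_def by (rule pred_intros_logic)
  qed
  have D_mono: "D t x" if "D s x" "s \<le> t" for s t x
    using that unfolding D_def by (meson enat_ord_simps(1) order_trans)
  define W where "W = stopped D"
  \<comment> \<open>The liminf is defined and measurable everywhere and fits Fatou's lemma; it is
    identified with a genuine limit only on the paths where this matters.\<close>
  define V where "V x = liminf (\<lambda>t. W t x)" for x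
  \<comment> \<open>Where \<open>V\<close> is infinite \<open>enn2real\<close> gives 0. This only
    lowers \<open>Y\<close>, which suits the upper bound on its mean; almost every path is shown
    below to have finite \<open>V\<close>.\<close>
  define Y where "Y x = enn2real (ennreal a * V x)" for x
  have W [measurable]: "W t \<in> borel_measurable P" for t
    unfolding W_def using measurable_stopped[OF D] measurable_F_P by blast
  have [measurable]: "W t \<in> borel_measurable (filtration_infinity P F)" for t
    unfolding W_def using measurable_stopped[OF D] measurable_filtration_infinity assms(2) by blast
  have V [measurable]: "V \<in> borel_measurable P" unfolding V_def by measurable
  have Y [measurable]: "Y \<in> borel_measurable P" unfolding Y_def by measurable
  have "Y \<in> borel_measurable (filtration_infinity P F)" unfolding Y_def V_def by measurable
  then have "indep_var borel U borel Y"
    using assms Y by (intro indep_var_of_filtration)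
  then have "emeasure P {x \<in> space P. U x \<le> Y x \<or> 1 \<le> Y x} \<le> (\<integral>\<^sup>+x. ennreal (Y x) \<partial>P)"
    using assms(8) by (rule emeasure_randomized_threshold_le) (simp add: Y_def)
  also have "\<dots> \<le> (\<integral>\<^sup>+x. ennreal a * V x \<partial>P)"
    unfolding Y_def by (intro nn_integral_mono) (metis ennreal_enn2real_if infinity_ennreal_def order_refl top_greatest zero_le)
  also have "\<dots> = ennreal a * (\<integral>\<^sup>+x. V x \<partial>P)"
    by (rule nn_integral_cmult) simp
  also have "(\<integral>\<^sup>+x. V x \<partial>P) \<le> 1"
  proof -
    have "(\<integral>\<^sup>+x. V x \<partial>P) \<le> liminf (\<lambda>t. \<integral>\<^sup>+x. W t x \<partial>P)"
      unfolding V_def by (intro nn_integral_liminf) simp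
    also have "\<dots> \<le> limsup (\<lambda>t. \<integral>\<^sup>+x. W t x \<partial>P)"
      by (rule Liminf_le_Limsup) simp
    also have "\<dots> \<le> (\<integral>\<^sup>+x. ennreal (M 0 x) \<partial>P)"
      unfolding W_def
      by (intro Limsup_bounded always_eventually allI nn_integral_stopped_le D)
         (auto intro: D_mono)
    also have "\<dots> = ennreal (\<integral>x. M 0 x \<partial>P)"
      using assms(3,4) by (intro nn_integral_eq_integral) (auto simp: supermartingale_def)
    also have "\<dots> \<le> 1" using assms(5) by (simp add: ennreal_le_1)
    finally show ?thesis .
  qed
  finally have bound: "emeasure P {x \<in> space P. U x \<le> Y x \<or> 1 \<le> Y x} \<le> ennreal a"
    by (simp add: mult_left_mono)
  have Y_of_V: "Y x = a * m" if "V x = ennreal m" "0 \<le> m" for x m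
    using that \<open>a > 0\<close> by (simp add: Y_def ennreal_mult[symmetric])
  have V_of_D: "V x = ennreal (M t x)" if "D t x" "\<And>s. s < t \<Longrightarrow> \<not> D s x" for t x
  proof -
    have "W u x = ennreal (M t x)" if "u \<ge> t" for u
      using stopped_const[of t D x u] stopped_eq[of t D x] D_mono \<open>D t x\<close> that \<open>\<And>s. s < t \<Longrightarrow> \<not> D s x\<close>
      unfolding W_def by metis
    then have "(\<lambda>u. W u x) \<longlonglongrightarrow> ennreal (M t x)"
      by (intro tendsto_eventually) (auto simp: eventually_sequentially)
    then show ?thesis unfolding V_def by (intro lim_imp_Liminf) auto
  qed
  have "AE x in P. \<forall>t. 0 \<le> M t x"
    using assms(4) by (simp add: AE_all_countable)
  with AE_convergent have sub: "AE x in P.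
    ((\<exists>t::nat. enat t < \<tau> x \<and> M t x \<ge> 1 / a) \<or> stopped_value M \<tau> x \<ge> U x / a) \<longrightarrow> U x \<le> Y x \<or> 1 \<le> Y x"
  proof eventually_elim
    case (elim x)
    show ?case
    proof (cases "\<exists>t. D t x")
      case True
      define t where "t = (LEAST t. D t x)"
      have t: "D t x" "\<And>s. s < t \<Longrightarrow> \<not> D s x"
        using LeastI_ex[OF True] not_less_Least unfolding t_def by blast+
      have Yt: "Y x = a * M t x" using Y_of_V V_of_D[OF t] elim by blast
      show ?thesis
      \<comment> \<open>At the first stopped time \<open>t\<close>, either the level has been
        reached, which gives \<open>1 \<le> Y x\<close>, or no earlier value reached it either. Then
        \<open>\<tau> x = enat t\<close>, and only the threshold event with \<open>M t x\<close> can
        occur.\<close>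
      proof (cases "1 / a \<le> M t x")
        case True
        then show ?thesis using Yt \<open>a > 0\<close> by (simp add: field_simps)
      next
        case False
        then have "\<not> (\<exists>s\<le>t. 1 / a \<le> M s x)"
          using t(2) unfolding D_def by (metis le_neq_implies_less order_refl)
        moreover from this have "\<tau> x \<le> enat t" using t(1) by (auto simp: D_def)
        moreover from this have "\<tau> x = enat t"
          using t(2) unfolding D_def by (metis enat_ile enat_ord_simps(1) le_neq_implies_less order_refl)
        ultimately show ?thesis
          using Yt \<open>a > 0\<close> by (auto simp: stopped_value_def field_simps)
      qed
    next
      case False
      then have small: "M t x < 1 / a" and "\<not> \<tau> x \<le> enat t" for t
        by (auto simp: D_def not_le)
      then have inf: "\<tau> x = \<infinity>" by (cases "\<tau> x") auto
      obtain l where l: "(\<lambda>t. ennreal (M t x)) \<longlonglongrightarrow> l" using elim by blast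
      \<comment> \<open>A path that is never stopped stays below \<open>1 / a\<close>, so its limit
        is finite. Hence \<open>lim\<close> in \<open>stopped_value\<close> is the true limit rather
        than an unspecified value.\<close>
      have "l \<le> ennreal (1 / a)"
        by (rule LIMSEQ_le_const2[OF l]) (use small in \<open>auto intro: ennreal_leI less_imp_le\<close>)
      then obtain m where m: "l = ennreal m" "0 \<le> m"
        by (cases l) (auto simp: top_unique)
      have "(\<lambda>t. M t x) \<longlonglongrightarrow> m"
        using tendsto_enn2real[of _ m] l m elim by fastforce
      then have "stopped_value M \<tau> x = m"
        by (simp add: stopped_value_def inf limI)
      moreover have "W t x = ennreal (M t x)" for t
        unfolding W_def using False by (intro stopped_eq) auto
      then have "V x = ennreal m"
        unfolding V_def using l m by (auto intro!: lim_imp_Liminf)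
      then have "Y x = a * m" using Y_of_V m by blast
      ultimately show ?thesis
        using small inf \<open>a > 0\<close> by (auto simp: field_simps not_less[symmetric])
    qed
  qed
  have "\<P>(x in P. (\<exists>t::nat. enat t < \<tau> x \<and> M t x \<ge> 1 / a) \<or> stopped_value M \<tau> x \<ge> U x / a)
      \<le> prob {x \<in> space P. U x \<le> Y x \<or> 1 \<le> Y x}"
  proof (rule finite_measure_mono_AE)
    show "AE x in P. x \<in> {x \<in> space P. (\<exists>t::nat. enat t < \<tau> x \<and> M t x \<ge> 1 / a) \<or> stopped_value M \<tau> x \<ge> U x / a} \<longrightarrow>
        x \<in> {x \<in> space P. U x \<le> Y x \<or> 1 \<le> Y x}"
      using sub by eventually_elim auto
  qed (use assms(7) in measurable)
  also have "\<dots> \<le> a"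
    using bound \<open>a > 0\<close> by (simp add: emeasure_eq_measure)
  finally show ?thesis .
qed

end
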